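(* Let $X$ be a locally compact Polish space. Then $\mathrm{R}(X)\cap\operatorname{Met}_{\mathrm{pr}}(X)$ is a $G_\delta$ subset of $\operatorname{Met}_{\mathrm{pr}}(X)$.
   Context: A Polish space is a separable completely metrizable space. For a metrizable space $X$, $\operatorname{Met}(X)$ denotes the set of all metrics on $X$ inducing the topology of $X$. For $d,e\in\operatorname{Met}(X)$, put $\mathcal D_X(d,e)=\sup_{x,y\in X}|d(x,y)-e(x,y)|\in[0,\infty]$ (taken to be $0$ if $X$ is empty). $\operatorname{Met}(X)$ carries the uniform topology, i.e. the topology induced by the metric $\min\{1,\mathcal D_X\}$. A proper metric is a metric for which every closed bounded ball $\{y\in X\mid d(x,y)\le r\}$ ($x\in X$, $r>0$) is compact. $\operatorname{Met}_{\mathrm{pr}}(X)$ denotes the set of proper metrics in $\operatorname{Met}(X)$, with the subspace topology from $\operatorname{Met}(X)$. $\operatorname{Isom}(X,d)$ is the group of bijective self-isometries of $(X,d)$. The set of rigid metrics is $\mathrm{R}(X)=\{d\in\operatorname{Met}(X)\mid \operatorname{Isom}(X,d)=\{\mathrm{id}_X\}\}$. *)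

theory Defs
  imports "HOL-Analysis.Analysis"
begin

definition Polish_space :: "'a topology \<Rightarrow> bool" where
  "Polish_space X \<longleftrightarrow> separable_space X \<and> completely_metrizable_space X"

(* A metric on the set topspace X is represented by a function on the whole type 'a. Its values
   outside topspace X are fixed to 0, so that each metric has exactly one representative
   (0 rather than undefined, because Metric_space requires 0 \<le> d x y on the whole type). *)
definition Met :: "'a topology \<Rightarrow> ('a \<Rightarrow> 'a \<Rightarrow> real) set" where
  "Met X = {d. Metric_space (topspace X) d \<and> Metric_space.mtopology (topspace X) d = X \<and>
               (\<forall>x y. x \<notin> topspace X \<or> y \<notin> topspace X \<longrightarrow> d x y = 0)}"

(* The supremum is taken in ennreal, where Sup {} = 0. *)
definition sup_dist ::
    "'a topology \<Rightarrow> ('a \<Rightarrow> 'a \<Rightarrow> real) \<Rightarrow> ('a \<Rightarrow> 'a \<Rightarrow> real) \<Rightarrow> ennreal" where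
  "sup_dist X d e = (SUP (x, y) \<in> topspace X \<times> topspace X. ennreal \<bar>d x y - e x y\<bar>)"

definition unif_dist ::
    "'a topology \<Rightarrow> ('a \<Rightarrow> 'a \<Rightarrow> real) \<Rightarrow> ('a \<Rightarrow> 'a \<Rightarrow> real) \<Rightarrow> real" where
  "unif_dist X d e = enn2real (min 1 (sup_dist X d e))"

lemma Metric_space_unif_dist: "Metric_space (Met X) (unif_dist X)"
proof
  fix d e :: "'a \<Rightarrow> 'a \<Rightarrow> real"
  show "0 \<le> unif_dist X d e"
    by (simp add: unif_dist_def)
  show "unif_dist X d e = unif_dist X e d"
    by (simp add: unif_dist_def sup_dist_def abs_minus_commute)
next
  fix d e :: "'a \<Rightarrow> 'a \<Rightarrow> real"
  assume d: "d \<in> Met X" and e: "e \<in> Met X"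
  show "unif_dist X d e = 0 \<longleftrightarrow> d = e"
  proof
    assume "unif_dist X d e = 0"
    then have "min 1 (sup_dist X d e) = 0"
      by (auto simp: unif_dist_def enn2real_eq_0_iff min_def top_unique split: if_splits)
    then have "sup_dist X d e = 0"
      by (auto simp: min_def split: if_splits)
    then have "d x y = e x y" if "x \<in> topspace X" "y \<in> topspace X" for x y
      using that by (auto simp: sup_dist_def bot_ennreal[symmetric] SUP_bot_conv)
         (auto simp: bot_ennreal)
    then show "d = e"
      using d e by (intro ext) (auto simp: Met_def, metis)
  next
    assume "d = e"
    have "sup_dist X e e \<le> 0"
      unfolding sup_dist_def by (intro SUP_least) auto
    with \<open>d = e\<close> show "unif_dist X d e = 0"
      by (simp add: unif_dist_def)
  qed
next
  fix d e f :: "'a \<Rightarrow> 'a \<Rightarrow> real"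
  have "sup_dist X d f \<le> sup_dist X d e + sup_dist X e f"
  proof (unfold sup_dist_def[of X d f], intro SUP_least, clarify)
    fix x y assume xy: "x \<in> topspace X" "y \<in> topspace X"
    have "ennreal \<bar>d x y - f x y\<bar> \<le> ennreal (\<bar>d x y - e x y\<bar> + \<bar>e x y - f x y\<bar>)"
      by (intro ennreal_leI) linarith
    also have "\<dots> = ennreal \<bar>d x y - e x y\<bar> + ennreal \<bar>e x y - f x y\<bar>"
      by simp
    also have "\<dots> \<le> sup_dist X d e + sup_dist X e f"
      unfolding sup_dist_def using xy
      by (intro add_mono SUP_upper2[where i = "(x, y)"]) auto
    finally show "ennreal \<bar>d x y - f x y\<bar> \<le> sup_dist X d e + sup_dist X e f" .
  qed
  then have "min 1 (sup_dist X d f) \<le> min 1 (sup_dist X d e) + min 1 (sup_dist X e f)"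
    by (cases "1 \<le> sup_dist X d e"; cases "1 \<le> sup_dist X e f")
      (simp_all add: min_absorb1 min_absorb2 min.coboundedI1 min.coboundedI2 add_increasing add_increasing2)
  then have "enn2real (min 1 (sup_dist X d f))
      \<le> enn2real (min 1 (sup_dist X d e) + min 1 (sup_dist X e f))"
    by (intro enn2real_mono) (auto simp: min_less_iff_disj)
  also have "\<dots> = enn2real (min 1 (sup_dist X d e)) + enn2real (min 1 (sup_dist X e f))"
    by (intro enn2real_plus) (auto simp: min_less_iff_disj)
  finally show "unif_dist X d f \<le> unif_dist X d e + unif_dist X e f"
    by (simp add: unif_dist_def)
qed

definition Met_topology :: "'a topology \<Rightarrow> ('a \<Rightarrow> 'a \<Rightarrow> real) topology" where
  "Met_topology X = Metric_space.mtopology (Met X) (unif_dist X)"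

definition proper_metric :: "'a set \<Rightarrow> ('a \<Rightarrow> 'a \<Rightarrow> real) \<Rightarrow> bool" where
  "proper_metric M d \<longleftrightarrow> Metric_space M d \<and>
     (\<forall>x\<in>M. \<forall>r>0. compactin (Metric_space.mtopology M d) (Metric_space.mcball M d x r))"

definition Met_pr :: "'a topology \<Rightarrow> ('a \<Rightarrow> 'a \<Rightarrow> real) set" where
  "Met_pr X = {d \<in> Met X. proper_metric (topspace X) d}"

definition Met_pr_topology :: "'a topology \<Rightarrow> ('a \<Rightarrow> 'a \<Rightarrow> real) topology" where
  "Met_pr_topology X = subtopology (Met_topology X) (Met_pr X)"

(* Self-maps of M are extensional functions, so that the identity of M is restrict id M. *)
definition Isom :: "'a set \<Rightarrow> ('a \<Rightarrow> 'a \<Rightarrow> real) \<Rightarrow> ('a \<Rightarrow> 'a) set" where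
  "Isom M d = {f \<in> M \<rightarrow>\<^sub>E M. bij_betw f M M \<and> (\<forall>x\<in>M. \<forall>y\<in>M. d (f x) (f y) = d x y)}"

definition rigid_metrics :: "'a topology \<Rightarrow> ('a \<Rightarrow> 'a \<Rightarrow> real) set" where
  "rigid_metrics X = {d \<in> Met X. Isom (topspace X) d = {restrict id (topspace X)}}"

end

theory Submission
  imports Defs
begin

text \<open>
  A nontrivial isometry moves some point of a countable dense set, so the complement of the rigid
  metrics is a countable union of sets consisting of the proper metrics \<open>d\<close> that admit an isometry
  \<open>f\<close> with \<open>d p (f p)\<close> in a given compact subinterval of the positive half-line. Each of these sets
  is closed: encode a bijective isometry by a pair \<open>(f, g)\<close> with \<open>d (f x) y = d x (g y)\<close> for all
  \<open>x, y\<close>. If metrics close to \<open>d\<close> admit such isometries, the pairs satisfying this equation up to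
  \<open>\<epsilon>\<close> form nested nonempty closed subsets of a product of \<open>d\<close>-balls, which is compact as \<open>d\<close> is
  proper, and any pair in their intersection is a bijective isometry of \<open>d\<close>.
\<close>

section \<open>Limits of approximate isometries of a proper metric\<close>

text \<open>Taking \<open>y = f x\<close>, respectively \<open>x = g y\<close>, makes one side
  vanish, so \<open>f\<close> and \<open>g\<close> are mutually inverse; replacing \<open>y\<close>
  by \<open>f y\<close> then gives distance preservation. Bijectivity is thus encoded by equations
  that survive pointwise limits.\<close>

lemma (in Metric_space) adjoint_pair_imp_Isom:
  assumes f: "f \<in> M \<rightarrow>\<^sub>E M" and g: "g \<in> M \<rightarrow> M"
    and adj: "\<And>x y. x \<in> M \<Longrightarrow> y \<in> M \<Longrightarrow> d (f x) y = d x (g y)"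
  shows "f \<in> Isom M d"
proof -
  have fM: "f x \<in> M" and gM: "g x \<in> M" if "x \<in> M" for x
    using f g that by auto
  have gf: "g (f x) = x" if "x \<in> M" for x
    using adj[of x "f x"] fM gM that by (metis mdist_zero zero)
  have fg: "f (g x) = x" if "x \<in> M" for x
    using adj[of "g x" x] fM gM that by (metis mdist_zero zero)
  have "bij_betw f M M"
    using fM gM gf fg by (intro bij_betwI[where g = g]) auto
  moreover have "d (f x) (f y) = d x y" if "x \<in> M" "y \<in> M" for x y
    using adj[of x "f y"] fM gf that by simp
  ultimately show ?thesis
    using f by (simp add: Isom_def)
qed

lemma (in Metric_space) continuous_map_d:
  assumes "continuous_map T mtopology f" "continuous_map T mtopology g"
  shows "continuous_map T euclideanreal (\<lambda>x. d (f x) (g x))"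
  using continuous_map_mdist[of T "metric (M, d)" f g] assms by simp

text \<open>The pairs for different \<epsilon> are unrelated. Tychonoff's theorem replaces a
  convergent subsequence: all relevant pairs lie in one compact product, where the approximate
  conditions cut out a decreasing sequence of nonempty closed sets.\<close>

lemma (in Metric_space) exists_Isom_of_approx_adjoint_pairs:
  assumes proper: "proper_metric M d" and p: "p \<in> M"
    and approx: "\<And>\<epsilon>. \<epsilon> > 0 \<Longrightarrow> \<exists>f g. f \<in> M \<rightarrow> M \<and> g \<in> M \<rightarrow> M \<and>
       (\<forall>x\<in>M. \<forall>y\<in>M. \<bar>d (f x) y - d x (g y)\<bar> \<le> \<epsilon>) \<and> d p (f p) \<in> {a - \<epsilon>..b + \<epsilon>}"
  shows "\<exists>f\<in>Isom M d. d p (f p) \<in> {a..b}"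
proof -
  \<comment> \<open>Keeps the radius of \<open>B x\<close> below positive, since
    \<open>proper_metric\<close> speaks of positive radii only.\<close>
  have b: "b \<ge> -1"
  proof -
    obtain f where "d p (f p) \<le> b + 1"
      using approx[of 1] by auto
    then show ?thesis
      using nonneg[of p "f p"] by linarith
  qed
  \<comment> \<open>The adjoint condition at \<open>(p, p)\<close> gives
    \<open>d p (g p) \<le> b + 2 * e k\<close>, and at \<open>(x, p)\<close> it gives
    \<open>d p (f x) \<le> d p x + b + 3 * e k\<close>. As \<open>e k \<le> 1\<close>, this ball
    serves every \<open>k\<close>.\<close>
  define B where "B x = mcball p (d p x + b + 3)" for x
  \<comment> \<open>The Boolean tag merges \<open>(f, g)\<close> into one point \<open>h\<close> of
    a product: \<open>h (True, x)\<close> is \<open>f x\<close> and \<open>h (False, x)\<close> is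
    \<open>g x\<close>.\<close>
  define I where "I = (UNIV :: bool set) \<times> M"
  define T where "T = product_topology (\<lambda>i. subtopology mtopology (B (snd i))) I"
  define e where "e k = inverse (real (Suc k))" for k
  have BM: "B x \<subseteq> M" for x
    unfolding B_def by auto
  have e01: "0 < e k" "e k \<le> 1" for k
    by (auto simp: e_def inverse_le_1_iff)
  have "compactin mtopology (B x)" for x
  proof -
    have "d p x + b + 3 > 0"
      using b nonneg[of p x] by linarith
    then show ?thesis
      using proper p by (auto simp: proper_metric_def B_def)
  qed
  then have "compact_space T"
    unfolding T_def by (auto simp: compact_space_product_topology compact_space_subtopology)
  have top: "topspace T = PiE I (\<lambda>i. B (snd i))"
    using BM by (auto simp: T_def Int_absorb1)
  have proj: "continuous_map T mtopology (\<lambda>h. h (s, x))" if "x \<in> M" for s x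
    unfolding T_def
    using continuous_map_product_projection[of "(s, x)" I "\<lambda>i. subtopology mtopology (B (snd i))"] that
    by (auto simp: I_def intro: continuous_map_into_fulltopology)
  have const: "continuous_map T mtopology (\<lambda>h. x)" if "x \<in> M" for x
    using that by simp
  define C where "C k = {h \<in> topspace T.
      (\<forall>x\<in>M. \<forall>y\<in>M. d (h (True, x)) y - d x (h (False, y)) \<in> {- e k..e k}) \<and>
      d p (h (True, p)) \<in> {a - e k..b + e k}}" for k
  have "closedin T (C k)" for k
  proof -
    \<comment> \<open>For fixed \<open>x\<close> and \<open>y\<close> the condition involves only
      two coordinates of \<open>h\<close>, hence is continuous in the product topology.\<close>
    have "closedin T {h \<in> topspace T. d (h (True, x)) y - d x (h (False, y)) \<in> {- e k..e k}}"
      if "x \<in> M" "y \<in> M" for x y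
    proof (rule closedin_continuous_map_preimage)
      show "continuous_map T euclideanreal (\<lambda>h. d (h (True, x)) y - d x (h (False, y)))"
        using that by (intro continuous_map_diff continuous_map_d[OF proj const]
            continuous_map_d[OF const proj])
    qed simp
    moreover have "closedin T {h \<in> topspace T. d p (h (True, p)) \<in> {a - e k..b + e k}}"
      by (rule closedin_continuous_map_preimage[OF continuous_map_d[OF const[OF p] proj[OF p]]])
        simp
    moreover have "C k = {h \<in> topspace T. d p (h (True, p)) \<in> {a - e k..b + e k}} \<inter>
        (\<Inter>x\<in>M. \<Inter>y\<in>M. {h \<in> topspace T. d (h (True, x)) y - d x (h (False, y)) \<in> {- e k..e k}})"
      using p by (auto simp: C_def simp del: atLeastAtMost_iff)
    moreover have "M \<noteq> {}"
      using p by auto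
    ultimately show ?thesis
      by (simp only:) (intro closedin_Int closedin_INT)
  qed
  moreover have "C k \<noteq> {}" for k
  proof -
    obtain f g where fg: "f \<in> M \<rightarrow> M" "g \<in> M \<rightarrow> M"
      and adj: "\<And>x y. x \<in> M \<Longrightarrow> y \<in> M \<Longrightarrow> \<bar>d (f x) y - d x (g y)\<bar> \<le> e k"
      and fp: "d p (f p) \<in> {a - e k..b + e k}"
      using approx[OF e01(1)[of k]] by blast
    have gp: "d p (g p) \<le> b + 2 * e k"
      using adj[OF p p] fp by (auto simp: commute)
    have "f x \<in> B x" "g x \<in> B x" if "x \<in> M" for x
    proof -
      have M: "f x \<in> M" "g x \<in> M" "f p \<in> M" "g p \<in> M"
        using fg that p by auto
      have "d p (f x) \<le> d x (g p) + e k"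
        using adj[OF that p] by (simp add: commute)
      moreover have "d x (g p) \<le> d p x + d p (g p)"
        using triangle[of x p "g p"] M that p by (simp add: commute)
      ultimately show "f x \<in> B x"
        using gp e01[of k] M p unfolding B_def by auto
      have "d p (g x) \<le> d (f p) x + e k"
        using adj[OF p that] by simp
      moreover have "d (f p) x \<le> d p x + d p (f p)"
        using triangle[of "f p" p x] M that p by (simp add: commute)
      ultimately show "g x \<in> B x"
        using fp e01[of k] M p unfolding B_def by auto
    qed
    moreover have "d (f x) y - d x (g y) \<in> {- e k..e k}" if "x \<in> M" "y \<in> M" for x y
      using adj[OF that] unfolding atLeastAtMost_iff by linarith
    ultimately have "restrict (\<lambda>(s, x). if s then f x else g x) I \<in> C k"
      using fp p unfolding C_def top by (auto simp: I_def simp del: atLeastAtMost_iff)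
    then show ?thesis by blast
  qed
  moreover have "decseq C"
  proof (intro decseq_SucI subsetI)
    fix k h assume "h \<in> C (Suc k)"
    moreover have "e (Suc k) \<le> e k"
      by (simp add: e_def)
    then have "{- e (Suc k)..e (Suc k)} \<subseteq> {- e k..e k}"
      and "{a - e (Suc k)..b + e (Suc k)} \<subseteq> {a - e k..b + e k}"
      by auto
    ultimately show "h \<in> C k"
      unfolding C_def by blast
  qed
  ultimately obtain h where h: "\<And>k. h \<in> C k"
    using compact_space_imp_nest[OF \<open>compact_space T\<close>, of C] by blast
  have lim: "u \<le> v" if "\<And>k. u \<le> v + e k" for u v :: real
    by (rule LIMSEQ_le_const[of "\<lambda>k. v + e k"])
      (use that tendsto_add[OF tendsto_const[of v] LIMSEQ_inverse_real_of_nat] in \<open>auto simp: e_def\<close>)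
  define f where "f = (\<lambda>x\<in>M. h (True, x))"
  define g where "g x = h (False, x)" for x
  have "f \<in> Isom M d"
  proof (rule adjoint_pair_imp_Isom)
    have "h (s, x) \<in> M" if "x \<in> M" for s x
      using h[of 0] BM[of x] that unfolding C_def top I_def by (auto simp: PiE_iff)
    then show "f \<in> M \<rightarrow>\<^sub>E M" "g \<in> M \<rightarrow> M"
      by (auto simp: f_def g_def)
    show "d (f x) y = d x (g y)" if "x \<in> M" "y \<in> M" for x y
    proof (rule antisym; rule lim)
      fix k
      have "d (h (True, x)) y - d x (h (False, y)) \<in> {- e k..e k}"
        using h[of k] that unfolding C_def by blast
      then show "d (f x) y \<le> d x (g y) + e k" "d x (g y) \<le> d (f x) y + e k"
        using that by (auto simp: f_def g_def)
    qed
  qed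
  moreover have "d p (f p) \<in> {a..b}"
  proof -
    have "d p (f p) \<in> {a - e k..b + e k}" for k
      using h[of k] p unfolding C_def f_def by simp
    then have "a \<le> d p (f p) + e k" "d p (f p) \<le> b + e k" for k
      by (simp_all add: diff_le_eq)
    then show ?thesis
      unfolding atLeastAtMost_iff by (blast intro: lim)
  qed
  ultimately show ?thesis by blast
qed

section \<open>Detecting nontrivial isometries on a dense set\<close>

lemma restrict_id_in_Isom: "restrict id M \<in> Isom M d"
  by (auto simp: Isom_def bij_betw_def inj_on_def)

text \<open>If \<open>f\<close> fixes \<open>x\<close>, then
  \<open>d z (f z) \<le> d z x + d (f z) (f x) = 2 * d z x\<close>. So a point \<open>z\<close> that
  \<open>f\<close> moves has no fixed point within half of its displacement.\<close>

lemma Isom_eq_id_if_fixes_dense: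
  assumes "Metric_space M d" and f: "f \<in> Isom M d"
    and dense: "Metric_space.mtopology M d closure_of D = M"
    and fix_D: "\<And>x. x \<in> D \<Longrightarrow> x \<in> M \<Longrightarrow> f x = x"
  shows "f = restrict id M"
proof -
  interpret Metric_space M d by fact
  have fM: "f \<in> M \<rightarrow>\<^sub>E M" and iso: "\<And>x y. x \<in> M \<Longrightarrow> y \<in> M \<Longrightarrow> d (f x) (f y) = d x y"
    using f by (auto simp: Isom_def)
  have "f z = z" if z: "z \<in> M" for z
  proof (rule ccontr)
    assume "f z \<noteq> z"
    moreover have fz: "f z \<in> M"
      using fM z by auto
    ultimately have "d z (f z) / 2 > 0"
      using z mdist_pos_eq[of z "f z"] by auto
    moreover have "z \<in> mtopology closure_of D"
      using dense z by simp
    ultimately obtain x where x: "x \<in> D" "x \<in> M" "d z x < d z (f z) / 2"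
      unfolding metric_closure_of by fastforce
    have "d z (f z) \<le> d z x + d (f z) (f x)"
      using triangle[of z x "f z"] fz x z fix_D[of x] by (simp add: commute)
    then show False
      using iso[of z x] x z by simp
  qed
  then show ?thesis
    using fM by (auto simp: fun_eq_iff PiE_iff extensional_def)
qed

section \<open>Closedness in the uniform topology\<close>

text \<open>The truncation of \<open>unif_dist\<close> at 1 loses nothing below 1, whence the
  restriction to \<open>\<epsilon> \<le> 1\<close>.\<close>

lemma unif_dist_less_imp:
  assumes less: "unif_dist X d e < \<epsilon>" and "\<epsilon> \<le> 1" and xy: "x \<in> topspace X" "y \<in> topspace X"
  shows "\<bar>d x y - e x y\<bar> < \<epsilon>"
proof -
  have "ennreal \<bar>d x y - e x y\<bar> \<le> sup_dist X d e"
    unfolding sup_dist_def using xy by (intro SUP_upper2[where i = "(x, y)"]) auto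
  then have "ennreal (min 1 \<bar>d x y - e x y\<bar>) \<le> min 1 (sup_dist X d e)"
    by (intro min.boundedI) (simp_all add: min.coboundedI1 order_trans[OF ennreal_leI[OF min.cobounded2]])
  then have "enn2real (ennreal (min 1 \<bar>d x y - e x y\<bar>)) \<le> unif_dist X d e"
    unfolding unif_dist_def by (intro enn2real_mono) (auto simp: min_less_iff_disj)
  then show ?thesis
    using assms(1,2) by (auto simp: min_def split: if_splits)
qed

text \<open>Used with compact intervals \<open>S\<close> in the positive half-line: the lower end
  keeps a limit isometry away from the identity, and the upper end confines the isometries to balls
  around \<open>p\<close>.\<close>

definition displacing_metrics :: "'a topology \<Rightarrow> 'a \<Rightarrow> real set \<Rightarrow> ('a \<Rightarrow> 'a \<Rightarrow> real) set" where
  "displacing_metrics X p S = {d \<in> Met_pr X. \<exists>f\<in>Isom (topspace X) d. d p (f p) \<in> S}"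

text \<open>An isometry of a metric \<open>e\<close> near \<open>d\<close>, paired with its inverse,
  satisfies the adjoint equation exactly for \<open>e\<close>, hence approximately for
  \<open>d\<close>.\<close>

lemma closedin_displacing_metrics:
  assumes p: "p \<in> topspace X"
  shows "closedin (Met_pr_topology X) (displacing_metrics X p {a..b})"
proof -
  let ?F = "displacing_metrics X p {a..b}"
  interpret U: Metric_space "Met X" "unif_dist X"
    by (rule Metric_space_unif_dist)
  have "d \<in> ?F" if d: "d \<in> Met_topology X closure_of ?F" "d \<in> Met_pr X" for d
  proof -
    interpret Metric_space "topspace X" d
      using d(2) by (simp add: Met_pr_def Met_def)
    have "\<exists>f\<in>Isom (topspace X) d. d p (f p) \<in> {a..b}"
    proof (rule exists_Isom_of_approx_adjoint_pairs)
      show "proper_metric (topspace X) d" "p \<in> topspace X"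
        using d(2) p by (auto simp: Met_pr_def)
      fix \<epsilon> :: real assume "\<epsilon> > 0"
      \<comment> \<open>Replacing \<open>e\<close> by \<open>d\<close> on both sides of the adjoint
        equation costs at most \<open>2 * \<delta>\<close>; the bound 1 respects the truncation of
        \<open>unif_dist\<close>.\<close>
      define \<delta> where "\<delta> = min 1 (\<epsilon> / 2)"
      have \<delta>: "\<delta> > 0" "\<delta> \<le> 1" "2 * \<delta> \<le> \<epsilon>"
        using \<open>\<epsilon> > 0\<close> by (auto simp: \<delta>_def)
      obtain e where e: "e \<in> ?F" "unif_dist X d e < \<delta>"
        using d(1) \<delta>(1) unfolding Met_topology_def U.metric_closure_of by auto
      then obtain f where f: "f \<in> Isom (topspace X) e" "e p (f p) \<in> {a..b}"
        by (auto simp: displacing_metrics_def)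
      have close: "\<bar>d x y - e x y\<bar> < \<delta>" if "x \<in> topspace X" "y \<in> topspace X" for x y
        using unif_dist_less_imp[OF e(2) \<delta>(2) that] .
      have fX: "f \<in> topspace X \<rightarrow> topspace X" and bij: "bij_betw f (topspace X) (topspace X)"
        and iso: "\<And>x y. x \<in> topspace X \<Longrightarrow> y \<in> topspace X \<Longrightarrow> e (f x) (f y) = e x y"
        using f(1) by (auto simp: Isom_def)
      define g where "g = inv_into (topspace X) f"
      have gX: "g \<in> topspace X \<rightarrow> topspace X"
        using bij by (auto simp: g_def bij_betw_def inv_into_into)
      have fg: "f (g y) = y" if "y \<in> topspace X" for y
        using bij that by (simp add: g_def bij_betw_inv_into_right)
      have "\<bar>d (f x) y - d x (g y)\<bar> \<le> \<epsilon>" if "x \<in> topspace X" "y \<in> topspace X" for x y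
      proof -
        have M: "f x \<in> topspace X" "g y \<in> topspace X"
          using fX gX that by auto
        then have "e (f x) y = e x (g y)"
          using iso[of x "g y"] fg that by simp
        then show ?thesis
          using close[of "f x" y] close[of x "g y"] M that \<delta>(3) by linarith
      qed
      moreover have "d p (f p) \<in> {a - \<epsilon>..b + \<epsilon>}"
        using close[OF p, of "f p"] f(2) funcset_mem[OF fX p] \<delta> by (auto simp: abs_less_iff)
      ultimately show "\<exists>f g. f \<in> topspace X \<rightarrow> topspace X \<and> g \<in> topspace X \<rightarrow> topspace X \<and>
         (\<forall>x\<in>topspace X. \<forall>y\<in>topspace X. \<bar>d (f x) y - d x (g y)\<bar> \<le> \<epsilon>) \<and>
         d p (f p) \<in> {a - \<epsilon>..b + \<epsilon>}"
        using fX gX by blast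
    qed
    then show ?thesis
      using d(2) by (simp add: displacing_metrics_def)
  qed
  moreover have "?F \<subseteq> Met_topology X closure_of ?F"
    by (rule closure_of_subset)
      (auto simp: Met_topology_def displacing_metrics_def Met_pr_def)
  moreover have "?F \<subseteq> Met_pr X"
    by (auto simp: displacing_metrics_def)
  ultimately have "Met_topology X closure_of ?F \<inter> Met_pr X = ?F"
    by blast
  \<comment> \<open>The set is the trace on \<open>Met_pr X\<close> of its closure in all of
    \<open>Met X\<close>.\<close>
  then show ?thesis
    unfolding Met_pr_topology_def closedin_subtopology by (metis closedin_closure_of)
qed

theorem proposition5p2:
  fixes X :: "'a topology"
  assumes "Polish_space X" and "locally_compact_space X"
  shows "gdelta_in (Met_pr_topology X) (rigid_metrics X \<inter> Met_pr X)"
proof -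
  obtain D where D: "countable D" "D \<subseteq> topspace X" "X closure_of D = topspace X"
    using assms(1) by (auto simp: Polish_space_def separable_space_def)
  have top: "topspace (Met_pr_topology X) = Met_pr X"
    by (auto simp: Met_pr_topology_def Met_topology_def Met_pr_def
        Metric_space.topspace_mtopology[OF Metric_space_unif_dist])
  \<comment> \<open>These intervals increase with \<open>n\<close> and exhaust the positive reals.
    With \<open>n\<close> for \<open>Suc n\<close>, the case \<open>n = 0\<close> would be
    \<open>{0..0}\<close>, as \<open>inverse 0 = 0\<close>, and would admit the identity.\<close>
  let ?F = "\<lambda>(p, n). displacing_metrics X p {inverse (real (Suc n))..real (Suc n)}"
  have "Met_pr X - rigid_metrics X = \<Union>(?F ` (D \<times> UNIV))"
  proof (intro equalityI subsetI)
    fix d assume "d \<in> Met_pr X - rigid_metrics X"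
    then have d: "d \<in> Met_pr X" "d \<in> Met X" "d \<notin> rigid_metrics X"
      by (auto simp: Met_pr_def)
    then interpret Metric_space "topspace X" d
      by (simp add: Met_def)
    obtain f where f: "f \<in> Isom (topspace X) d" "f \<noteq> restrict id (topspace X)"
      using d restrict_id_in_Isom[of "topspace X" d] by (auto simp: rigid_metrics_def)
    then obtain p where p: "p \<in> D" "f p \<noteq> p"
      using Isom_eq_id_if_fixes_dense[OF Metric_space_axioms f(1), of D] D(3) d(2)
      by (auto simp: Met_def)
    moreover have "p \<in> topspace X" "f p \<in> topspace X"
      using p(1) D(2) f(1) by (auto simp: Isom_def)
    ultimately have "d p (f p) > 0"
      using mdist_pos_eq[of p "f p"] by auto
    then obtain m where m: "inverse (real (Suc m)) < d p (f p)"
      using reals_Archimedean by blast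
    obtain n where n: "d p (f p) \<le> real n"
      using real_arch_simple by blast
    \<comment> \<open>Since the intervals increase, the index \<open>max m n\<close> meets the lower
      bound from \<open>m\<close> and the upper bound from \<open>n\<close> at once.\<close>
    have "inverse (real (Suc (max m n))) \<le> inverse (real (Suc m))"
      by (intro le_imp_inverse_le) auto
    moreover have "real n \<le> real (Suc (max m n))"
      by simp
    ultimately have "d p (f p) \<in> {inverse (real (Suc (max m n)))..real (Suc (max m n))}"
      using m n unfolding atLeastAtMost_iff by linarith
    then have "d \<in> ?F (p, max m n)"
      using d(1) f(1) by (auto simp: displacing_metrics_def)
    then show "d \<in> \<Union>(?F ` (D \<times> UNIV))"
      using p(1) by blast
  next
    fix d assume "d \<in> \<Union>(?F ` (D \<times> UNIV))"
    then obtain p n f where p: "p \<in> D" and d: "d \<in> Met_pr X" and f: "f \<in> Isom (topspace X) d"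
      and le: "inverse (real (Suc n)) \<le> d p (f p)"
      by (auto simp: displacing_metrics_def)
    interpret Metric_space "topspace X" d
      using d by (simp add: Met_pr_def Met_def)
    have "d p p = 0"
      using p D(2) by auto
    moreover have "0 < inverse (real (Suc n))"
      by simp
    ultimately have "f p \<noteq> p"
      using le by auto
    then have "f \<noteq> restrict id (topspace X)"
      using p D(2) by auto
    then show "d \<in> Met_pr X - rigid_metrics X"
      using d f by (auto simp: rigid_metrics_def)
  qed
  moreover have "fsigma_in (Met_pr_topology X) (\<Union>(?F ` (D \<times> UNIV)))"
  proof (rule fsigma_in_Union)
    show "countable (?F ` (D \<times> UNIV))"
      using D(1) by simp
    show "fsigma_in (Met_pr_topology X) S" if S: "S \<in> ?F ` (D \<times> UNIV)" for S
      using S D(2) by (auto intro!: closed_imp_fsigma_in closedin_displacing_metrics)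
  qed
  ultimately show ?thesis
    by (simp add: gdelta_in_fsigma_in top Diff_Int)
qed

end
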